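(* Let $A\subset S$ with $\pi(A)\le 1/2$ be a set achieving the Cheeger constant $h_P$, and assume $h_P\le 1-\pi(A)$ (at equality the bound below has zero numerator). Then there exists $x^*\in A$ with $P(x^*,A)\ge 1-h_P$, and $$M\;\ge\;r(x^* )\;\ge\;\frac{(1-h_P)\log\dfrac{1-h_P}{\pi(A)}+h_P\log\dfrac{h_P}{1-\pi(A)}}{\log\bigl(1/\pi(x^* )\bigr)}.$$ The term involving $h_P$, namely $h_P\log\frac{h_P}{1-\pi(A)}$, is interpreted by continuity as $0$ when $h_P=0$. In particular, for small $h_P$, $M\gtrsim\log(1/\pi(A))/\log(1/\pi_{\min})$.
   Context: $P$ is a Markov transition kernel on a finite state space $S$ with $|S|\ge2$, with a stationary distribution $\pi$ of full support ($\pi(x)>0$ for all $x\in S$). All logarithms are natural, with $0\log 0=0$. $D_{\mathrm{KL}}(\mu\|\nu)=\sum_{x\in S}\mu(x)\log\frac{\mu(x)}{\nu(x)}$. The local KL retention ratio is $r(x):=D_{\mathrm{KL}}(P(x,\cdot)\|\pi)/\log(1/\pi(x))$, and $M:=\max_{x\in S}r(x)$. $\pi_{\min}:=\min_{x\in S}\pi(x)$, $\pi(A)=\sum_{x\in A}\pi(x)$, $P(x,A)=\sum_{y\in A}P(x,y)$. The Cheeger constant of $P$ is $$h_P:=\min_{\substack{A\subset S\\0<\pi(A)\le 1/2}}\frac{\sum_{x\in A,\,y\notin A}\pi(x)P(x,y)}{\pi(A)},$$ and a set $A$ achieves the Cheeger constant if it attains this minimum. *)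

theory Defs
  imports "HOL-Probability.Probability"
begin

(* The state space is a finite set S rather than a finite type, so that bounds which are
   uniform over all chains can be expressed.  Only the values of the kernel P on S matter. *)
definition finite_markov_chain :: "'a set \<Rightarrow> ('a \<Rightarrow> 'a pmf) \<Rightarrow> 'a pmf \<Rightarrow> bool" where
  "finite_markov_chain S P \<pi> \<longleftrightarrow>
     finite S \<and> card S \<ge> 2 \<and> (\<forall>x\<in>S. set_pmf (P x) \<subseteq> S) \<and>
     set_pmf \<pi> = S \<and> bind_pmf \<pi> P = \<pi>"

(* The convention 0 log 0 = 0 is automatic, since the logarithm is multiplied by pmf \<mu> x. *)
definition kl_div :: "'a set \<Rightarrow> 'a pmf \<Rightarrow> 'a pmf \<Rightarrow> real" where
  "kl_div S \<mu> \<nu> = (\<Sum>x\<in>S. pmf \<mu> x * ln (pmf \<mu> x / pmf \<nu> x))"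

lemma kl_div_eq_KL_divergence:
  assumes "finite S" "set_pmf \<mu> \<subseteq> S" "set_pmf \<nu> = S"
  shows "kl_div S \<mu> \<nu> = KL_divergence (exp 1) (measure_pmf \<nu>) (measure_pmf \<mu>)"
proof -
  have pos: "pmf \<nu> x > 0" if "x \<in> S" for x
    using that assms(3) by (simp add: pmf_positive)
  have "measure_pmf \<mu> = density (measure_pmf \<nu>) (\<lambda>x. ennreal (pmf \<mu> x / pmf \<nu> x))"
  proof -
    have "density (measure_pmf \<nu>) (\<lambda>x. ennreal (pmf \<mu> x / pmf \<nu> x))
        = density (count_space UNIV) (\<lambda>x. ennreal (pmf \<nu> x) * ennreal (pmf \<mu> x / pmf \<nu> x))"
      by (subst measure_pmf_eq_density) (simp add: density_density_eq)
    also have "(\<lambda>x. ennreal (pmf \<nu> x) * ennreal (pmf \<mu> x / pmf \<nu> x)) = (\<lambda>x. ennreal (pmf \<mu> x))"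
    proof
      fix x
      show "ennreal (pmf \<nu> x) * ennreal (pmf \<mu> x / pmf \<nu> x) = ennreal (pmf \<mu> x)"
      proof (cases "x \<in> S")
        case True
        with pos[OF True] show ?thesis
          by (simp flip: ennreal_mult')
      next
        case False
        with assms have "pmf \<mu> x = 0" by (auto simp: set_pmf_iff)
        then show ?thesis by simp
      qed
    qed
    finally show ?thesis by (simp add: measure_pmf_eq_density)
  qed
  moreover have "KL_divergence (exp 1) (measure_pmf \<nu>)
      (density (measure_pmf \<nu>) (\<lambda>x. ennreal (pmf \<mu> x / pmf \<nu> x)))
      = (\<integral>x. (pmf \<mu> x / pmf \<nu> x) * log (exp 1) (pmf \<mu> x / pmf \<nu> x) \<partial>measure_pmf \<nu>)"
    by (rule sigma_finite_measure.KL_density[OF measure_pmf.sigma_finite_measure_axioms]) auto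
  moreover have "\<dots> = (\<Sum>x\<in>S. (pmf \<mu> x / pmf \<nu> x) * log (exp 1) (pmf \<mu> x / pmf \<nu> x) * pmf \<nu> x)"
    using assms by (intro integral_measure_pmf_real) auto
  moreover have "\<dots> = kl_div S \<mu> \<nu>"
    unfolding kl_div_def
  proof (intro sum.cong refl)
    fix x assume "x \<in> S"
    from pos[OF this] show "(pmf \<mu> x / pmf \<nu> x) * log (exp 1) (pmf \<mu> x / pmf \<nu> x) * pmf \<nu> x
        = pmf \<mu> x * ln (pmf \<mu> x / pmf \<nu> x)"
      by (simp add: log_def)
  qed
  ultimately show ?thesis by simp
qed

definition kl_retention :: "'a set \<Rightarrow> ('a \<Rightarrow> 'a pmf) \<Rightarrow> 'a pmf \<Rightarrow> 'a \<Rightarrow> real" where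
  "kl_retention S P \<pi> x = kl_div S (P x) \<pi> / ln (1 / pmf \<pi> x)"

definition max_kl_retention :: "'a set \<Rightarrow> ('a \<Rightarrow> 'a pmf) \<Rightarrow> 'a pmf \<Rightarrow> real" where
  "max_kl_retention S P \<pi> = Max (kl_retention S P \<pi> ` S)"

definition min_prob :: "'a set \<Rightarrow> 'a pmf \<Rightarrow> real" where
  "min_prob S \<pi> = Min (pmf \<pi> ` S)"

definition conductance :: "'a set \<Rightarrow> ('a \<Rightarrow> 'a pmf) \<Rightarrow> 'a pmf \<Rightarrow> 'a set \<Rightarrow> real" where
  "conductance S P \<pi> A =
     (\<Sum>x\<in>A. \<Sum>y\<in>S - A. pmf \<pi> x * pmf (P x) y) / measure_pmf.prob \<pi> A"

definition cheeger_sets :: "'a set \<Rightarrow> 'a pmf \<Rightarrow> 'a set set" where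
  "cheeger_sets S \<pi> =
     {A. A \<subseteq> S \<and> 0 < measure_pmf.prob \<pi> A \<and> measure_pmf.prob \<pi> A \<le> 1 / 2}"

definition cheeger_const :: "'a set \<Rightarrow> ('a \<Rightarrow> 'a pmf) \<Rightarrow> 'a pmf \<Rightarrow> real" where
  "cheeger_const S P \<pi> = Min (conductance S P \<pi> ` cheeger_sets S \<pi>)"

definition achieves_cheeger :: "'a set \<Rightarrow> ('a \<Rightarrow> 'a pmf) \<Rightarrow> 'a pmf \<Rightarrow> 'a set \<Rightarrow> bool" where
  "achieves_cheeger S P \<pi> A \<longleftrightarrow>
     A \<in> cheeger_sets S \<pi> \<and> conductance S P \<pi> A = cheeger_const S P \<pi>"

end

theory Submission
  imports Defs "HOL-Real_Asymp.Real_Asymp"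
begin

text \<open>
  The escape probabilities \<open>P(x, S - A)\<close>, averaged over \<open>x \<in> A\<close> with weights
  \<open>\<pi>(x) / \<pi>(A)\<close>, equal \<open>h\<^sub>P\<close>, so some \<open>x \<in> A\<close> has
  \<open>P(x, A) \<ge> 1 - h\<^sub>P\<close>. The divergence \<open>D(\<mu> \<parallel> \<pi>)\<close> of \<open>\<mu> = P(x, \<cdot>)\<close> dominates
  \<open>\<mu>(A) ln (b / \<pi>(A)) + (1 - \<mu>(A)) ln ((1 - b) / (1 - \<pi>(A)))\<close> for every \<open>b\<close>
  (Gibbs' inequality against the tilt of \<open>\<pi>\<close> giving mass \<open>b\<close> to \<open>A\<close>). For
  \<open>b = 1 - h\<^sub>P \<ge> \<pi>(A)\<close> the first logarithm is nonnegative and the second nonpositive, so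
  \<open>\<mu>(A)\<close> may be lowered to \<open>b\<close>. For small \<open>h\<^sub>P\<close> the numerator is \<open>(1 - h\<^sub>P) ln (1 / \<pi>(A))\<close>
  up to the binary entropy of \<open>h\<^sub>P\<close>, which is negligible against \<open>ln (1 / \<pi>(A)) \<ge> ln 2\<close>.
\<close>

section \<open>Lower bounds for the KL divergence\<close>

text \<open>Convexity: as a function of \<open>p\<close>, the right side is the tangent to
  \<open>p * ln (p / w)\<close> at \<open>p = w * c\<close>. The proof applies ln t \<le> t - 1 at
  \<open>t = w * c / p\<close>.\<close>

lemma gibbs_tangent:
  fixes p w c :: real
  assumes "p \<ge> 0" "w > 0" "c \<ge> 0" "c = 0 \<Longrightarrow> p = 0"
  shows "p * ln (p / w) \<ge> p * ln c + p - w * c"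
proof (cases "p = 0")
  case True
  then show ?thesis using assms by simp
next
  case False
  then have p: "p > 0" and c: "c > 0" using assms by (auto simp: less_le)
  have "ln (w * c / p) \<le> w * c / p - 1"
    using p c assms by (intro ln_le_minus_one) simp
  then have "p * ln (w * c / p) \<le> p * (w * c / p - 1)"
    using p by (intro mult_left_mono) auto
  moreover have "p * (w * c / p - 1) = w * c - p"
    using p by (simp add: field_simps)
  moreover have "ln (w * c / p) = ln c - ln (p / w)"
    using p c assms by (simp add: ln_div ln_mult)
  ultimately have "p * (ln c - ln (p / w)) \<le> w * c - p" by simp
  then show ?thesis by (simp add: algebra_simps)
qed

lemma prob_eq_sum_pmf:
  assumes "finite A"
  shows "measure_pmf.prob \<mu> A = (\<Sum>x\<in>A. pmf \<mu> x)"
  using assms by (rule measure_measure_pmf_finite)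

lemma prob_Diff_support:
  assumes "set_pmf \<mu> \<subseteq> S" "A \<subseteq> S"
  shows "measure_pmf.prob \<mu> (S - A) = 1 - measure_pmf.prob \<mu> A"
proof -
  have "measure_pmf.prob \<mu> S = 1"
    using assms(1) by (simp add: measure_pmf.prob_eq_1 AE_measure_pmf_iff subset_eq)
  then show ?thesis
    using assms(2) measure_pmf.finite_measure_Diff[of S \<mu> A] by simp
qed

text \<open>With \<open>b\<close> equal to the \<open>\<mu>\<close>-mass of \<open>A\<close> this is
  data processing for the partition of \<open>S\<close> into \<open>A\<close> and its complement.
  Taking the tangents at a smaller \<open>b\<close> gives a bound that is linear in that mass, so a
  lower bound on the mass suffices.\<close>

lemma kl_div_ge_binary:
  assumes "finite S" "A \<subseteq> S" "set_pmf \<mu> \<subseteq> S" "set_pmf \<nu> = S"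
    and a: "a = measure_pmf.prob \<nu> A" "0 < a" "a < 1"
    and b: "a \<le> b" "b \<le> 1" "b \<le> measure_pmf.prob \<mu> A"
  shows "kl_div S \<mu> \<nu> \<ge> b * ln (b / a) + (1 - b) * ln ((1 - b) / (1 - a))"
proof -
  \<comment> \<open>\<open>c\<close> is the density with respect to \<open>\<nu>\<close> of the tilt
    of \<open>\<nu>\<close> that has mass \<open>b\<close> on \<open>A\<close>.\<close>
  define c where "c y = (if y \<in> A then b / a else (1 - b) / (1 - a))" for y
  define q where "q = measure_pmf.prob \<mu> A"
  have fA: "finite A" "finite (S - A)" using assms finite_subset by auto
  have q: "q \<le> 1" "b \<le> q" using b by (auto simp: q_def)
  have split_sum: "(\<Sum>y\<in>S. f y) = (\<Sum>y\<in>A. f y) + (\<Sum>y\<in>S - A. f y)" for f :: "'a \<Rightarrow> real"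
    using assms by (metis add.commute sum.subset_diff)
  have \<mu>c: "(\<Sum>y\<in>S - A. pmf \<mu> y) = 1 - q"
    using prob_Diff_support[of \<mu> S A] assms fA by (simp add: prob_eq_sum_pmf q_def)
  have \<nu>c: "(\<Sum>y\<in>S - A. pmf \<nu> y) = 1 - a"
    using prob_Diff_support[of \<nu> S A] assms fA by (simp add: prob_eq_sum_pmf)
  have "(\<Sum>y\<in>S. pmf \<mu> y * ln (c y) + pmf \<mu> y - pmf \<nu> y * c y) \<le> kl_div S \<mu> \<nu>"
    unfolding kl_div_def
  proof (intro sum_mono gibbs_tangent)
    fix y assume y: "y \<in> S"
    show "pmf \<nu> y > 0" using y assms by (simp add: pmf_positive)
    show "c y \<ge> 0" using a b by (simp add: c_def)
    \<comment> \<open>\<open>c\<close> vanishes only off \<open>A\<close> and only for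
      \<open>b = 1\<close>; then \<open>b \<le> q\<close> leaves \<open>\<mu>\<close> no mass
      outside \<open>A\<close>.\<close>
    show "pmf \<mu> y = 0" if "c y = 0"
    proof -
      have "y \<notin> A" "b = 1" using that a b by (auto simp: c_def split: if_splits)
      then have "(\<Sum>y\<in>S - A. pmf \<mu> y) = 0" using \<mu>c q by simp
      then show ?thesis using fA y \<open>y \<notin> A\<close> by (simp add: sum_nonneg_eq_0_iff)
    qed
  qed simp
  also have "(\<Sum>y\<in>S. pmf \<mu> y * ln (c y) + pmf \<mu> y - pmf \<nu> y * c y)
      = q * ln (b / a) + q - a * (b / a)
        + ((1 - q) * ln ((1 - b) / (1 - a)) + (1 - q) - (1 - a) * ((1 - b) / (1 - a)))"
  proof -
    have "(\<Sum>y\<in>A. pmf \<mu> y * ln (c y) + pmf \<mu> y - pmf \<nu> y * c y)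
        = (\<Sum>y\<in>A. pmf \<mu> y * ln (b / a) + pmf \<mu> y - pmf \<nu> y * (b / a))"
      by (simp add: c_def)
    also have "\<dots> = q * ln (b / a) + q - a * (b / a)"
      using fA by (simp only: sum.distrib sum_subtractf flip: sum_distrib_right)
        (simp add: a q_def prob_eq_sum_pmf)
    finally have "(\<Sum>y\<in>A. pmf \<mu> y * ln (c y) + pmf \<mu> y - pmf \<nu> y * c y) = \<dots>" .
    moreover have "(\<Sum>y\<in>S - A. pmf \<mu> y * ln (c y) + pmf \<mu> y - pmf \<nu> y * c y)
        = (\<Sum>y\<in>S - A. pmf \<mu> y * ln ((1 - b) / (1 - a)) + pmf \<mu> y
             - pmf \<nu> y * ((1 - b) / (1 - a)))"
      by (intro sum.cong refl) (simp add: c_def)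
    moreover have "\<dots> = (1 - q) * ln ((1 - b) / (1 - a)) + (1 - q)
        - (1 - a) * ((1 - b) / (1 - a))"
      by (simp only: sum.distrib sum_subtractf \<mu>c \<nu>c flip: sum_distrib_right)
    ultimately show ?thesis by (simp only: split_sum)
  qed
  \<comment> \<open>The non-logarithmic terms cancel because \<open>\<mu>\<close> and the tilt both
    have total mass 1.\<close>
  also have "\<dots> = q * ln (b / a) + (1 - q) * ln ((1 - b) / (1 - a))"
    using a by simp
  finally have "q * ln (b / a) + (1 - q) * ln ((1 - b) / (1 - a)) \<le> kl_div S \<mu> \<nu>" .
  moreover have "b * ln (b / a) + (1 - b) * ln ((1 - b) / (1 - a))
      \<le> q * ln (b / a) + (1 - q) * ln ((1 - b) / (1 - a))"
  proof -
    have "(q - b) * ln (b / a) \<ge> 0"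
      using a b q by (intro mult_nonneg_nonneg ln_ge_zero) auto
    moreover have "(q - b) * ln ((1 - b) / (1 - a)) \<le> 0"
    \<comment> \<open>For \<open>b = 1\<close> the logarithm is \<open>ln 0\<close>, which is 0 by
      convention.\<close>
    proof (cases "b = 1")
      case False
      then have "ln ((1 - b) / (1 - a)) \<le> 0"
        using a b by (intro ln_le_zero_iff[THEN iffD2]) auto
      then show ?thesis using q by (intro mult_nonneg_nonpos) auto
    qed simp
    ultimately show ?thesis by (simp add: algebra_simps)
  qed
  ultimately show ?thesis by linarith
qed

section \<open>The Cheeger set and the retention bound\<close>

text \<open>If every escape probability from \<open>A\<close> exceeded the Cheeger constant, so
  would their \<open>\<pi>\<close>-weighted average over \<open>A\<close>, which is the conductance
  of \<open>A\<close>.\<close>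

lemma achieves_cheeger_point:
  assumes "finite_markov_chain S P \<pi>" "achieves_cheeger S P \<pi> A"
  shows "\<exists>x\<in>A. measure_pmf.prob (P x) A \<ge> 1 - cheeger_const S P \<pi>"
proof (rule ccontr)
  assume "\<not> ?thesis"
  then have less: "measure_pmf.prob (P x) A < 1 - cheeger_const S P \<pi>" if "x \<in> A" for x
    using that by (auto simp: not_le)
  define h where "h = cheeger_const S P \<pi>"
  have S: "finite S" "\<And>x. x \<in> S \<Longrightarrow> set_pmf (P x) \<subseteq> S" "set_pmf \<pi> = S"
    using assms by (auto simp: finite_markov_chain_def)
  have A: "A \<subseteq> S" "measure_pmf.prob \<pi> A > 0" and cond: "conductance S P \<pi> A = h"
    using assms by (auto simp: achieves_cheeger_def cheeger_sets_def h_def)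
  have fA: "finite A" using A S finite_subset by auto
  have "A \<noteq> {}" using A by auto
  have "h * measure_pmf.prob \<pi> A = (\<Sum>x\<in>A. pmf \<pi> x * h)"
    using fA by (simp add: prob_eq_sum_pmf sum_distrib_left mult.commute)
  also have "\<dots> < (\<Sum>x\<in>A. pmf \<pi> x * measure_pmf.prob (P x) (S - A))"
  proof (intro sum_strict_mono fA \<open>A \<noteq> {}\<close> mult_strict_left_mono)
    fix x assume "x \<in> A"
    with A S show "0 < pmf \<pi> x" by (auto intro: pmf_positive)
    show "h < measure_pmf.prob (P x) (S - A)"
      using less[OF \<open>x \<in> A\<close>] prob_Diff_support[of "P x" S A] S A \<open>x \<in> A\<close>
      by (auto simp: h_def)
  qed
  also have "\<dots> = (\<Sum>x\<in>A. \<Sum>y\<in>S - A. pmf \<pi> x * pmf (P x) y)"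
    using S by (simp add: prob_eq_sum_pmf sum_distrib_left)
  also have "\<dots> = h * measure_pmf.prob \<pi> A"
    using cond A by (simp add: conductance_def field_simps)
  finally show False by simp
qed

lemma cheeger_const_nonneg:
  assumes "achieves_cheeger S P \<pi> A"
  shows "cheeger_const S P \<pi> \<ge> 0"
proof -
  have "conductance S P \<pi> A \<ge> 0"
    unfolding conductance_def by (intro divide_nonneg_nonneg sum_nonneg) auto
  then show ?thesis using assms by (simp add: achieves_cheeger_def)
qed

text \<open>Full support on at least two states. This makes the denominators
  \<open>ln (1 / pmf \<pi> x)\<close> positive.\<close>

lemma pmf_less_1_of_chain:
  assumes "finite_markov_chain S P \<pi>" "x \<in> S"
  shows "pmf \<pi> x < 1"
proof (rule ccontr)
  assume "\<not> pmf \<pi> x < 1"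
  then have "pmf \<pi> x = 1" using pmf_le_1[of \<pi> x] by linarith
  then have "measure_pmf.prob \<pi> {x} = 1" by (simp add: measure_pmf_single)
  then have "set_pmf \<pi> \<subseteq> {x}"
    by (auto simp: measure_pmf.prob_eq_1 AE_measure_pmf_iff)
  then have "card S \<le> card {x}"
    using assms by (intro card_mono) (auto simp: finite_markov_chain_def)
  then show False using assms by (simp add: finite_markov_chain_def)
qed

lemma retention_bound:
  assumes chain: "finite_markov_chain S P \<pi>" and ach: "achieves_cheeger S P \<pi> A"
    and h: "h = cheeger_const S P \<pi>" and a: "a = measure_pmf.prob \<pi> A" and "h \<le> 1 - a"
  shows "\<exists>x\<in>A. measure_pmf.prob (P x) A \<ge> 1 - h \<and>
    max_kl_retention S P \<pi> \<ge> kl_retention S P \<pi> x \<and>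
    kl_retention S P \<pi> x
      \<ge> ((1 - h) * ln ((1 - h) / a) + h * ln (h / (1 - a))) / ln (1 / pmf \<pi> x)"
proof -
  obtain x where x: "x \<in> A" "measure_pmf.prob (P x) A \<ge> 1 - h"
    using achieves_cheeger_point[OF chain ach] h by auto
  have A: "A \<subseteq> S" "0 < a" "a \<le> 1 / 2"
    using ach a by (auto simp: achieves_cheeger_def cheeger_sets_def)
  have S: "finite S" "set_pmf (P x) \<subseteq> S" "set_pmf \<pi> = S" "x \<in> S"
    using chain x A by (auto simp: finite_markov_chain_def)
  have "0 \<le> h" using cheeger_const_nonneg[OF ach] h by simp
  \<comment> \<open>The binary bound with \<open>b = 1 - h\<close>: its condition
    \<open>a \<le> b\<close> is the hypothesis \<open>h \<le> 1 - a\<close>.\<close>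
  have "(1 - h) * ln ((1 - h) / a) + (1 - (1 - h)) * ln ((1 - (1 - h)) / (1 - a))
      \<le> kl_div S (P x) \<pi>"
    using S A x a \<open>0 \<le> h\<close> \<open>h \<le> 1 - a\<close> by (intro kl_div_ge_binary[of S A]) auto
  moreover have "ln (1 / pmf \<pi> x) \<ge> 0"
    using S pmf_less_1_of_chain[OF chain S(4)] pmf_positive[of x \<pi>]
    by (intro ln_ge_zero) auto
  ultimately have "kl_retention S P \<pi> x
      \<ge> ((1 - h) * ln ((1 - h) / a) + h * ln (h / (1 - a))) / ln (1 / pmf \<pi> x)"
    unfolding kl_retention_def by (intro divide_right_mono) auto
  moreover have "max_kl_retention S P \<pi> \<ge> kl_retention S P \<pi> x"
    unfolding max_kl_retention_def using S by (intro Max_ge) auto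
  ultimately show ?thesis using x by auto
qed

section \<open>Asymptotics for a small Cheeger constant\<close>

text \<open>The divisor \<open>ln 2\<close> is the least value of ln (1/a) for a \<le> 1/2. Using it
  instead of ln (1/a) makes \<open>\<delta>\<close> depend on \<open>\<epsilon>\<close> alone, hence
  uniform over all chains.\<close>

lemma binary_entropy_negligible:
  assumes "\<epsilon> > (0::real)"
  shows "\<exists>\<delta>>0. \<forall>h. 0 \<le> h \<and> h \<le> \<delta> \<longrightarrow>
    1 - \<epsilon> \<le> 1 - h + ((1 - h) * ln (1 - h) + h * ln h) / ln 2"
proof -
  let ?f = "\<lambda>h::real. 1 - h + ((1 - h) * ln (1 - h) + h * ln h) / ln 2"
  have "(?f \<longlongrightarrow> 1) (at_right 0)"
    by real_asymp
  then have "\<forall>\<^sub>F h in at_right 0. ?f h > 1 - \<epsilon>"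
    using assms by (intro order_tendstoD) auto
  then obtain d where d: "d > 0" "\<And>h. 0 < h \<Longrightarrow> h < d \<Longrightarrow> ?f h > 1 - \<epsilon>"
    unfolding eventually_at_right_field by blast
  \<comment> \<open>Halving \<open>d\<close> turns the strict bound into a closed one. The one-sided
    limit says nothing at \<open>h = 0\<close>, where \<open>?f\<close> equals 1.\<close>
  have "1 - \<epsilon> \<le> ?f h" if "0 \<le> h" "h \<le> d / 2" for h
  proof (cases "h = 0")
    case False
    then show ?thesis using that d by (intro less_imp_le d(2)) auto
  qed (use assms in simp)
  then show ?thesis using d(1) by (intro exI[of _ "d / 2"]) auto
qed

text \<open>Expanding the logarithms, the right side is \<open>(1 - h) * ln (1 / a)\<close> plus the
  negative entropy \<open>E\<close> plus the nonnegative term \<open>- h * ln (1 - a)\<close>. Since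
  \<open>E \<le> 0\<close> and \<open>ln (1 / a) \<ge> ln 2\<close>, \<open>E\<close> is at least
  \<open>E / ln 2\<close> times \<open>ln (1 / a)\<close>.\<close>

lemma binary_divergence_ge:
  fixes a h :: real
  assumes a: "0 < a" "a \<le> 1 / 2" and h: "0 \<le> h" "h \<le> 1 - a"
    and \<epsilon>: "1 - \<epsilon> \<le> 1 - h + ((1 - h) * ln (1 - h) + h * ln h) / ln 2"
  shows "(1 - \<epsilon>) * ln (1 / a) \<le> (1 - h) * ln ((1 - h) / a) + h * ln (h / (1 - a))"
proof -
  define E where "E = (1 - h) * ln (1 - h) + h * ln h"
  have "ln 2 \<le> ln (1 / a)"
    using a by (subst ln_le_cancel_iff) (auto simp: field_simps)
  have "h < 1" using a h by linarith
  have "(1 - h) * ln (1 - h) \<le> 0"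
    using h \<open>h < 1\<close> by (intro mult_nonneg_nonpos) auto
  moreover have "h * ln h \<le> 0"
    using h \<open>h < 1\<close> by (cases "h = 0") (auto intro: mult_nonneg_nonpos)
  ultimately have "E \<le> 0" by (simp add: E_def)
  have "(1 - \<epsilon>) * ln (1 / a) \<le> (1 - h + E / ln 2) * ln (1 / a)"
    using \<epsilon> \<open>ln 2 \<le> ln (1 / a)\<close> ln_2_less_1
    by (intro mult_right_mono) (auto simp: E_def intro: order_trans[of _ "ln 2"])
  also have "\<dots> = (1 - h) * ln (1 / a) + E * (ln (1 / a) / ln 2)"
    by (simp add: algebra_simps)
  also have "E * (ln (1 / a) / ln 2) \<le> E * 1"
    using \<open>E \<le> 0\<close> \<open>ln 2 \<le> ln (1 / a)\<close> by (intro mult_left_mono_neg) auto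
  also have "(1 - h) * ln (1 / a) + E * 1
      \<le> (1 - h) * ln (1 / a) + (1 - h) * ln (1 - h) + h * (ln h - ln (1 - a))"
  proof -
    have "h * ln (1 - a) \<le> 0" using a h by (intro mult_nonneg_nonpos) auto
    then show ?thesis by (simp add: E_def algebra_simps)
  qed
  also have "\<dots> = (1 - h) * ln ((1 - h) / a) + h * ln (h / (1 - a))"
    using a h \<open>h < 1\<close> by (cases "h = 0") (auto simp: ln_div algebra_simps)
  finally show ?thesis by simp
qed

theorem theorem6p1:
  shows
   "(\<forall>(S :: 'a set) P \<pi> A.
       finite_markov_chain S P \<pi> \<and> A \<subseteq> S \<and> measure_pmf.prob \<pi> A \<le> 1 / 2 \<and>
       achieves_cheeger S P \<pi> A \<and>
       cheeger_const S P \<pi> \<le> 1 - measure_pmf.prob \<pi> A \<longrightarrow>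
       (\<exists>x\<in>A. measure_pmf.prob (P x) A \<ge> 1 - cheeger_const S P \<pi> \<and>
          max_kl_retention S P \<pi> \<ge> kl_retention S P \<pi> x \<and>
          kl_retention S P \<pi> x \<ge>
            ((1 - cheeger_const S P \<pi>) *
                ln ((1 - cheeger_const S P \<pi>) / measure_pmf.prob \<pi> A) +
              cheeger_const S P \<pi> *
                ln (cheeger_const S P \<pi> / (1 - measure_pmf.prob \<pi> A)))
            / ln (1 / pmf \<pi> x))) \<and>
    (\<forall>\<epsilon>>0. \<exists>\<delta>>0. \<forall>(S :: 'a set) P \<pi> A.
       finite_markov_chain S P \<pi> \<and> A \<subseteq> S \<and> measure_pmf.prob \<pi> A \<le> 1 / 2 \<and>
       achieves_cheeger S P \<pi> A \<and>
       cheeger_const S P \<pi> \<le> 1 - measure_pmf.prob \<pi> A \<and>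
       cheeger_const S P \<pi> \<le> \<delta> \<longrightarrow>
       max_kl_retention S P \<pi> \<ge>
         (1 - \<epsilon>) * (ln (1 / measure_pmf.prob \<pi> A) / ln (1 / min_prob S \<pi>)))"
proof (intro conjI allI impI; (elim conjE)?)
  fix S :: "'a set" and P \<pi> A
  assume "finite_markov_chain S P \<pi>" "achieves_cheeger S P \<pi> A"
    "cheeger_const S P \<pi> \<le> 1 - measure_pmf.prob \<pi> A"
  then show "\<exists>x\<in>A. measure_pmf.prob (P x) A \<ge> 1 - cheeger_const S P \<pi> \<and>
      max_kl_retention S P \<pi> \<ge> kl_retention S P \<pi> x \<and>
      kl_retention S P \<pi> x \<ge>
        ((1 - cheeger_const S P \<pi>) *
            ln ((1 - cheeger_const S P \<pi>) / measure_pmf.prob \<pi> A) +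
          cheeger_const S P \<pi> *
            ln (cheeger_const S P \<pi> / (1 - measure_pmf.prob \<pi> A)))
        / ln (1 / pmf \<pi> x)"
    by (intro retention_bound) auto
next
  fix \<epsilon> :: real assume "\<epsilon> > 0"
  \<comment> \<open>The cap at 1 keeps \<open>1 - e\<close> nonnegative, so that replacing
    \<open>min_prob S \<pi>\<close> by the larger \<open>pmf \<pi> x\<close> can only increase the
    bound.\<close>
  define e where "e = min \<epsilon> 1"
  have e: "0 < e" "e \<le> 1" "e \<le> \<epsilon>" using \<open>\<epsilon> > 0\<close> by (auto simp: e_def)
  obtain \<delta> where \<delta>: "\<delta> > 0" "\<And>h. 0 \<le> h \<Longrightarrow> h \<le> \<delta> \<Longrightarrow>
      1 - e \<le> 1 - h + ((1 - h) * ln (1 - h) + h * ln h) / ln 2"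
    using binary_entropy_negligible[OF e(1)] by blast
  have "max_kl_retention S P \<pi> \<ge>
      (1 - \<epsilon>) * (ln (1 / measure_pmf.prob \<pi> A) / ln (1 / min_prob S \<pi>))"
    if chain: "finite_markov_chain S P \<pi>" and ach: "achieves_cheeger S P \<pi> A"
      and le: "cheeger_const S P \<pi> \<le> 1 - measure_pmf.prob \<pi> A"
      and small: "cheeger_const S P \<pi> \<le> \<delta>" for S :: "'a set" and P \<pi> A
  proof -
    define a where "a = measure_pmf.prob \<pi> A"
    define h where "h = cheeger_const S P \<pi>"
    define N where "N = (1 - h) * ln ((1 - h) / a) + h * ln (h / (1 - a))"
    have A: "A \<subseteq> S" "0 < a" "a \<le> 1 / 2"
      using ach by (auto simp: achieves_cheeger_def cheeger_sets_def a_def)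
    have h: "0 \<le> h" "h \<le> 1 - a" "h \<le> \<delta>"
      using cheeger_const_nonneg[OF ach] le small by (auto simp: a_def h_def)
    obtain x where x: "x \<in> A" and bound: "max_kl_retention S P \<pi> \<ge> N / ln (1 / pmf \<pi> x)"
      using retention_bound[OF chain ach h_def a_def h(2)] unfolding N_def by force
    have S: "finite S" "set_pmf \<pi> = S" "x \<in> S"
      using chain x A by (auto simp: finite_markov_chain_def)
    have "min_prob S \<pi> \<in> pmf \<pi> ` S"
      unfolding min_prob_def using S by (intro Min_in) auto
    then have min_pos: "min_prob S \<pi> > 0" using S by (auto intro: pmf_positive)
    have min_le: "min_prob S \<pi> \<le> pmf \<pi> x"
      unfolding min_prob_def using S by (intro Min_le) auto
    have x_pos: "ln (1 / pmf \<pi> x) > 0"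
      using pmf_less_1_of_chain[OF chain S(3)] pmf_positive[of x \<pi>] S
      by (intro ln_gt_zero) auto
    have x_le: "ln (1 / pmf \<pi> x) \<le> ln (1 / min_prob S \<pi>)"
      using min_pos min_le by (simp add: ln_div)
    have la: "ln (1 / a) \<ge> 0" using A by (intro ln_ge_zero) auto
    have "(1 - \<epsilon>) * (ln (1 / a) / ln (1 / min_prob S \<pi>))
        \<le> (1 - e) * (ln (1 / a) / ln (1 / min_prob S \<pi>))"
      using e la x_le x_pos by (intro mult_right_mono divide_nonneg_nonneg) linarith+
    also have "\<dots> \<le> (1 - e) * (ln (1 / a) / ln (1 / pmf \<pi> x))"
      using e la x_le x_pos by (intro mult_left_mono divide_left_mono mult_pos_pos) linarith+
    also have "\<dots> = ((1 - e) * ln (1 / a)) / ln (1 / pmf \<pi> x)" by simp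
    also have "\<dots> \<le> N / ln (1 / pmf \<pi> x)"
      unfolding N_def using A h \<delta>(2)[OF h(1,3)] x_pos
      by (intro divide_right_mono binary_divergence_ge) auto
    also note bound
    finally show ?thesis by (simp add: a_def)
  qed
  then show "\<exists>\<delta>>0. \<forall>(S :: 'a set) P \<pi> A.
       finite_markov_chain S P \<pi> \<and> A \<subseteq> S \<and> measure_pmf.prob \<pi> A \<le> 1 / 2 \<and>
       achieves_cheeger S P \<pi> A \<and>
       cheeger_const S P \<pi> \<le> 1 - measure_pmf.prob \<pi> A \<and>
       cheeger_const S P \<pi> \<le> \<delta> \<longrightarrow>
       max_kl_retention S P \<pi> \<ge>
         (1 - \<epsilon>) * (ln (1 / measure_pmf.prob \<pi> A) / ln (1 / min_prob S \<pi>))"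
    using \<delta>(1) by blast
qed

end
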